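(* Let $\mathfrak g$ be a finite-dimensional real Lie algebra admitting ad-invariant metrics. Then $$\bigcap_{X\in\mathfrak g}[\mathfrak z(X),\mathfrak g]=0 .$$ If moreover $[\mathfrak g,\mathfrak g]\neq\mathfrak g$, then for any vector space direct sum decomposition $\mathfrak g=\mathfrak v_1\oplus\cdots\oplus\mathfrak v_s\oplus[\mathfrak g,\mathfrak g]$ with $s\ge 1$ and $\mathfrak v_i\neq0$ for $i=1,\dots,s$, one has $$\Theta_{\mathfrak v_1,\ldots,\mathfrak v_s}:=\mathfrak z\cap\bigcap_{i=1}^{s}[\mathfrak z(\mathfrak v_i),\mathfrak g]=0 .$$
   Context: An ad-invariant metric on a real Lie algebra $\mathfrak g$ is a nondegenerate symmetric bilinear form $\langle\cdot,\cdot\rangle:\mathfrak g\times\mathfrak g\to\mathbb R$ (not necessarily positive definite) such that $\langle [X,Y],Z\rangle+\langle Y,[X,Z]\rangle=0$ for all $X,Y,Z\in\mathfrak g$. $\mathfrak z$ denotes the center of $\mathfrak g$. For a subspace $\mathfrak v\subset\mathfrak g$, $\mathfrak z(\mathfrak v)=\{X\in\mathfrak g:[X,\mathfrak v]=0\}$ is its centralizer in $\mathfrak g$; for $X\in\mathfrak g$, $\mathfrak z(X)=\mathfrak z(\mathbb R X)$. For subspaces $\mathfrak a,\mathfrak c$ of $\mathfrak g$, $[\mathfrak a,\mathfrak c]$ denotes the linear span of all brackets $[A,C]$ with $A\in\mathfrak a$, $C\in\mathfrak c$. *)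

theory Defs
  imports "HOL-Analysis.Analysis"
begin

text \<open>
  A real Lie algebra is a real vector space, the whole type \<open>'a\<close>, together with a bracket.
  The class \<open>real_vector\<close> is used instead of \<open>euclidean_space\<close>, which would fix an inner
  product and exclude the zero space.
\<close>

definition lie_algebra :: "('a::real_vector \<Rightarrow> 'a \<Rightarrow> 'a) \<Rightarrow> bool" where
  "lie_algebra br \<longleftrightarrow>
     bilinear br \<and>
     (\<forall>X. br X X = 0) \<and>
     (\<forall>X Y Z. br X (br Y Z) + br Y (br Z X) + br Z (br X Y) = 0)"

definition finite_dimensional_space :: "'a::real_vector itself \<Rightarrow> bool" where
  "finite_dimensional_space _ \<longleftrightarrow> (\<exists>B::'a set. finite B \<and> span B = UNIV)"

definition ad_invariant_metric ::
    "('a::real_vector \<Rightarrow> 'a \<Rightarrow> 'a) \<Rightarrow> ('a \<Rightarrow> 'a \<Rightarrow> real) \<Rightarrow> bool" where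
  "ad_invariant_metric br m \<longleftrightarrow>
     bilinear m \<and>
     (\<forall>X Y. m X Y = m Y X) \<and>
     (\<forall>X. (\<forall>Y. m X Y = 0) \<longrightarrow> X = 0) \<and>
     (\<forall>X Y Z. m (br X Y) Z + m Y (br X Z) = 0)"

definition centralizer :: "('a::real_vector \<Rightarrow> 'a \<Rightarrow> 'a) \<Rightarrow> 'a set \<Rightarrow> 'a set" where
  "centralizer br V = {X. \<forall>Y\<in>V. br X Y = 0}"

definition lie_center :: "('a::real_vector \<Rightarrow> 'a \<Rightarrow> 'a) \<Rightarrow> 'a set" where
  "lie_center br = {X. \<forall>Y. br X Y = 0}"

definition bracket_span ::
    "('a::real_vector \<Rightarrow> 'a \<Rightarrow> 'a) \<Rightarrow> 'a set \<Rightarrow> 'a set \<Rightarrow> 'a set" where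
  "bracket_span br A C = span {br X Y | X Y. X \<in> A \<and> Y \<in> C}"

text \<open>
  The whole space is the internal direct sum of the subspaces \<open>V i\<close>, \<open>i \<in> I\<close>, for a finite
  index set \<open>I\<close>.  Components are required to vanish outside \<open>I\<close> only to make the family
  \<open>x\<close> of components unique as a function.
\<close>

definition direct_sum_decomposition :: "'i set \<Rightarrow> ('i \<Rightarrow> 'a::real_vector set) \<Rightarrow> bool" where
  "direct_sum_decomposition I V \<longleftrightarrow>
     finite I \<and>
     (\<forall>i\<in>I. subspace (V i)) \<and>
     (\<forall>X. \<exists>!x. (\<forall>i\<in>I. x i \<in> V i) \<and> (\<forall>i. i \<notin> I \<longrightarrow> x i = 0) \<and> X = (\<Sum>i\<in>I. x i))"

definition Theta ::
    "('a::real_vector \<Rightarrow> 'a \<Rightarrow> 'a) \<Rightarrow> nat \<Rightarrow> (nat \<Rightarrow> 'a set) \<Rightarrow> 'a set" where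
  "Theta br s v =
     lie_center br \<inter> (\<Inter>i\<in>{1..s}. bracket_span br (centralizer br (v i)) UNIV)"

end

theory Submission
  imports Defs
begin

text \<open>
  Fix an ad-invariant metric. Invariance makes \<open>[\<zz>(V), \<gg>]\<close> orthogonal to \<open>V\<close>
  and \<open>\<zz>\<close> orthogonal to \<open>[\<gg>, \<gg>]\<close>. In both parts, an element of the intersection
  is therefore orthogonal to a spanning set of \<open>\<gg>\<close>, and nondegeneracy makes it zero.
\<close>

lemma lie_algebra_antisym:
  assumes "lie_algebra br"
  shows "br X Y = - br Y X"
proof -
  have bil: "bilinear br" and alt: "\<And>X. br X X = 0"
    using assms by (auto simp: lie_algebra_def)
  \<comment> \<open>Polarization: in the expansion of the right-hand side the terms
    \<open>br X X\<close> and \<open>br Y Y\<close> vanish.\<close>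
  have "br X Y + br Y X = br (X + Y) (X + Y)"
    unfolding bilinear_ladd[OF bil] bilinear_radd[OF bil] by (simp add: alt)
  also have "\<dots> = 0" by (rule alt)
  finally show ?thesis by (rule eq_neg_iff_add_eq_0[THEN iffD2])
qed

text \<open>On a generator \<open>br A W\<close> with \<open>A\<close> centralizing
  \<open>V\<close>, invariance moves \<open>A\<close> to the other argument:
  \<open>m (br A W) X = - m W (br A X) = 0\<close>. For fixed \<open>X\<close> the zeros of
  \<open>m U X\<close> in \<open>U\<close> form a subspace, so the span inherits this.\<close>

lemma bracket_span_centralizer_orthogonal:
  assumes m: "ad_invariant_metric br m"
    and U: "U \<in> bracket_span br (centralizer br V) C" and X: "X \<in> V"
  shows "m U X = 0"
  using U unfolding bracket_span_def
proof (induction rule: span_induct)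
  case base
  have "bilinear m" using m by (simp add: ad_invariant_metric_def)
  then show ?case
    by (auto simp: subspace_def bilinear_lzero bilinear_ladd bilinear_lmul)
next
  case (step U)
  then obtain A W where U: "U = br A W" and "br A X = 0"
    using X by (auto simp: centralizer_def)
  moreover have "m (br A W) X + m W (br A X) = 0" and "bilinear m"
    using m by (auto simp: ad_invariant_metric_def)
  ultimately show ?case by (simp add: bilinear_rzero)
qed

text \<open>Symmetry and invariance give \<open>m U (br Y Z) = - m Z (br Y U)\<close>, which
  vanishes for central \<open>U\<close>; linearity in the second argument extends this to the
  span.\<close>

lemma lie_center_orthogonal_bracket_span:
  assumes lie: "lie_algebra br" and m: "ad_invariant_metric br m"
    and U: "U \<in> lie_center br" and X: "X \<in> bracket_span br A C"
  shows "m U X = 0"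
  using X unfolding bracket_span_def
proof (induction rule: span_induct)
  case base
  have "bilinear m" using m by (simp add: ad_invariant_metric_def)
  then show ?case
    by (auto simp: subspace_def bilinear_rzero bilinear_radd bilinear_rmul)
next
  case (step X)
  then obtain Y Z where X: "X = br Y Z" by auto
  \<comment> \<open>\<open>lie_center\<close> puts the central element on the left, while invariance
    produces it on the right; antisymmetry bridges the two.\<close>
  have "br Y U = 0"
    using U lie_algebra_antisym[OF lie, of Y U] by (simp add: lie_center_def)
  moreover have "m (br Y Z) U + m Z (br Y U) = 0" "m U (br Y Z) = m (br Y Z) U" "bilinear m"
    using m by (auto simp: ad_invariant_metric_def)
  ultimately show ?case by (simp add: X bilinear_rzero)
qed

lemma zero_in_bracket_span: "0 \<in> bracket_span br A C"
  by (simp add: bracket_span_def span_zero)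

theorem proposition2p3:
  fixes br :: "'a::real_vector \<Rightarrow> 'a \<Rightarrow> 'a"
  assumes "lie_algebra br"
    and "finite_dimensional_space TYPE('a)"
    and "\<exists>m. ad_invariant_metric br m"
  shows "(\<Inter>X. bracket_span br (centralizer br (span {X})) UNIV) = {0} \<and>
    (bracket_span br UNIV UNIV \<noteq> UNIV \<longrightarrow>
      (\<forall>(s::nat) (v :: nat \<Rightarrow> 'a set).
         s \<ge> 1 \<longrightarrow>
         (\<forall>i\<in>{1..s}. v i \<noteq> {0}) \<longrightarrow>
         direct_sum_decomposition {1..s + 1} (v(s + 1 := bracket_span br UNIV UNIV)) \<longrightarrow>
         Theta br s v = {0}))"
proof -
  obtain m where m: "ad_invariant_metric br m" using assms(3) by blast
  then have nondeg: "U = 0" if "\<And>X. m U X = 0" for U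
    using that by (auto simp: ad_invariant_metric_def)
  have bil_br: "bilinear br" using assms(1) by (simp add: lie_algebra_def)
  have lin: "linear (m U)" for U
    using m by (simp add: ad_invariant_metric_def bilinear_def)
  have "U = 0" if "U \<in> (\<Inter>X. bracket_span br (centralizer br (span {X})) UNIV)" for U
  proof (rule nondeg)
    fix X
    \<comment> \<open>For each test vector \<open>X\<close>, only the member of the intersection
      indexed by that same \<open>X\<close> matters, since \<open>X\<close> lies in
      \<open>span {X}\<close>.\<close>
    have "U \<in> bracket_span br (centralizer br (span {X})) UNIV" using that by blast
    then show "m U X = 0"
      using bracket_span_centralizer_orthogonal[OF m] by (blast intro: span_base)
  qed
  then have part1: "(\<Inter>X. bracket_span br (centralizer br (span {X})) UNIV) = {0}"
    using zero_in_bracket_span by blast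
  have part2: "Theta br s v = {0}"
    if dec: "direct_sum_decomposition {1..s + 1} (v(s + 1 := bracket_span br UNIV UNIV))"
    for s :: nat and v :: "nat \<Rightarrow> 'a set"
  proof -
    have "U = 0" if U: "U \<in> Theta br s v" for U
    proof (rule nondeg)
      fix X
      obtain x where x: "\<And>i. i \<in> {1..s + 1} \<Longrightarrow> x i \<in> (v(s + 1 := bracket_span br UNIV UNIV)) i"
        and X: "X = (\<Sum>i\<in>{1..s + 1}. x i)"
        using dec unfolding direct_sum_decomposition_def by metis
      have "m U (x i) = 0" if i: "i \<in> {1..s + 1}" for i
      \<comment> \<open>The last index carries the derived algebra, where centrality of
        \<open>U\<close> applies; each other index \<open>i\<close> uses the factor of
        \<open>Theta\<close> belonging to \<open>v i\<close>.\<close>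
      proof (cases "i = s + 1")
        case True
        then have "x i \<in> bracket_span br UNIV UNIV" using x[OF i] by simp
        moreover have "U \<in> lie_center br" using U by (simp add: Theta_def)
        ultimately show ?thesis
          using lie_center_orthogonal_bracket_span[OF assms(1) m] by blast
      next
        case False
        then have "x i \<in> v i" and "i \<in> {1..s}" using x[OF i] i by auto
        moreover from this have "U \<in> bracket_span br (centralizer br (v i)) UNIV"
          using U unfolding Theta_def by blast
        ultimately show ?thesis using bracket_span_centralizer_orthogonal[OF m] by blast
      qed
      then have "(\<Sum>i\<in>{1..s + 1}. m U (x i)) = 0" by (rule sum.neutral[OF ballI])
      then show "m U X = 0" unfolding X linear_sum[OF lin] .
    qed
    moreover have "0 \<in> Theta br s v"
      by (simp add: Theta_def lie_center_def zero_in_bracket_span bilinear_lzero[OF bil_br])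
    ultimately show ?thesis by blast
  qed
  show ?thesis by (intro conjI impI allI part1 part2)
qed

end
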